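(* Let $n\in\mathbb{N}$ with $n\ge 1$ and let $M\in\mathbb{Z}^{n\times n}$. (i) If $M=N^TN$ with $N\in\mathbb{Z}^{n\times n}$, and $N=a1_n^T+1_nb^T+N_0+(\operatorname{wt}N)\,\mathcal{E}_n$ is the canonical decomposition of $N$, then $n^2\operatorname{wt}N\in\mathbb{Z}$, $n^2a_j\in\mathbb{Z}$ and $n^2b_j\in\mathbb{Z}$ for all $j\in\{1,\dots,n\}$, and $$n^4\operatorname{wt}M = n\,(n^2\operatorname{wt}N)^2+\sum_{j=1}^n (n^2a_j)^2.$$ (ii) Similarly, if $M=N^2$ with $N\in\mathbb{Z}^{n\times n}$, and $N=a1_n^T+1_nb^T+N_0+(\operatorname{wt}N)\,\mathcal{E}_n$ is the canonical decomposition of $N$, then $n^2\operatorname{wt}N\in\mathbb{Z}$, $n^2a_j\in\mathbb{Z}$ and $n^2b_j\in\mathbb{Z}$ for all $j\in\{1,\dots,n\}$, and $$n^4\operatorname{wt}M = n\,(n^2\operatorname{wt}N)^2+\sum_{j=1}^n (n^2a_j)(n^2b_j).$$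
   Context: Notation: $1_n\in\mathbb{R}^n$ is the column vector with all entries equal to $1$; $\mathcal{E}_n = 1_n1_n^T$. For $M=(m_{i,j})\in\mathbb{R}^{n\times n}$, $\operatorname{wt} M = \frac{1}{n^2}\sum_{i,j=1}^n m_{i,j}$. Every $N\in\mathbb{R}^{n\times n}$ has a unique (canonical) decomposition $N=a1_n^T+1_nb^T+N_0+(\operatorname{wt}N)\,\mathcal{E}_n$ in which $a,b\in\mathbb{R}^n$ satisfy $1_n^Ta=1_n^Tb=0$ and $N_0\in\mathbb{R}^{n\times n}$ has all row sums and all column sums equal to $0$; the entries of $a$ and $b$ are $a_i=\frac1n\sum_{j=1}^n n_{i,j}-\operatorname{wt}N$ and $b_j=\frac1n\sum_{i=1}^n n_{i,j}-\operatorname{wt}N$, where $N=(n_{i,j})$. *)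

theory Defs
  imports "HOL-Analysis.Analysis"
begin

text \<open>The matrix \<open>u v\<^sup>T\<close>. The vector \<open>1\<close> of type \<open>real ^ 'n\<close> is the all-ones vector
  (the instance of class one for vectors is pointwise), so \<open>outer a 1\<close> is \<open>a 1\<^sub>n\<^sup>T\<close>.\<close>

definition outer :: "real ^ 'm \<Rightarrow> real ^ 'n \<Rightarrow> real ^ 'n ^ 'm" where
  "outer u v = (\<chi> i j. u $ i * v $ j)"

definition ones_matrix :: "real ^ 'n ^ 'n" where
  "ones_matrix = outer 1 1"

definition wt :: "real ^ 'n ^ 'n \<Rightarrow> real" where
  "wt M = (\<Sum>i\<in>UNIV. \<Sum>j\<in>UNIV. M $ i $ j) / (real CARD('n))\<^sup>2"

definition real_matrix :: "int ^ 'n ^ 'm \<Rightarrow> real ^ 'n ^ 'm" where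
  "real_matrix A = map_matrix real_of_int A"

definition canonical_decomposition ::
    "real ^ 'n ^ 'n \<Rightarrow> real ^ 'n \<Rightarrow> real ^ 'n \<Rightarrow> real ^ 'n ^ 'n \<Rightarrow> bool" where
  "canonical_decomposition N a b N0 \<longleftrightarrow>
     N = outer a 1 + outer 1 b + N0 + wt N *\<^sub>R ones_matrix \<and>
     (\<Sum>i\<in>UNIV. a $ i) = 0 \<and> (\<Sum>j\<in>UNIV. b $ j) = 0 \<and>
     (\<forall>i. (\<Sum>j\<in>UNIV. N0 $ i $ j) = 0) \<and>
     (\<forall>j. (\<Sum>i\<in>UNIV. N0 $ i $ j) = 0)"

text \<open>Hence every \<open>N\<close> has exactly one canonical decomposition, so a hypothesis
  \<open>canonical_decomposition N a b N0\<close> only names its components.\<close>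

lemma canonical_decomposition_iff:
  fixes N N0 :: "real ^ 'n ^ 'n" and a b :: "real ^ 'n"
  shows "canonical_decomposition N a b N0 \<longleftrightarrow>
     a = (\<chi> i. (\<Sum>j\<in>UNIV. N $ i $ j) / real CARD('n) - wt N) \<and>
     b = (\<chi> j. (\<Sum>i\<in>UNIV. N $ i $ j) / real CARD('n) - wt N) \<and>
     N0 = N - outer a 1 - outer 1 b - wt N *\<^sub>R ones_matrix"
    (is "?L \<longleftrightarrow> ?R")
proof
  let ?n = "real CARD('n)"
  have n: "?n > 0" by simp
  show ?R if L: ?L
  proof -
    have N: "N $ i $ j = a $ i + b $ j + N0 $ i $ j + wt N" for i j
    proof -
      have "N $ i $ j = (outer a 1 + outer 1 b + N0 + wt N *\<^sub>R ones_matrix) $ i $ j"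
        using L unfolding canonical_decomposition_def by metis
      then show ?thesis by (simp add: outer_def ones_matrix_def)
    qed
    have "a $ i = (\<Sum>j\<in>UNIV. N $ i $ j) / ?n - wt N" for i
    proof -
      have "(\<Sum>j\<in>UNIV. N $ i $ j) = ?n * a $ i + ?n * wt N"
        using L by (subst N) (simp add: sum.distrib canonical_decomposition_def)
      then show ?thesis by (simp add: field_simps)
    qed
    moreover have "b $ j = (\<Sum>i\<in>UNIV. N $ i $ j) / ?n - wt N" for j
    proof -
      have "(\<Sum>i\<in>UNIV. N $ i $ j) = ?n * b $ j + ?n * wt N"
        using L by (subst N) (simp add: sum.distrib canonical_decomposition_def)
      then show ?thesis by (simp add: field_simps)
    qed
    moreover have "N0 = N - outer a 1 - outer 1 b - wt N *\<^sub>R ones_matrix"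
      by (simp add: vec_eq_iff N outer_def ones_matrix_def)
    ultimately show ?R by (simp add: vec_eq_iff)
  qed
  show ?L if R: ?R
  proof -
    let ?S = "\<Sum>i\<in>UNIV. \<Sum>j\<in>UNIV. N $ i $ j"
    have w: "?n * wt N = ?S / ?n"
      by (simp add: wt_def power2_eq_square)
    have S': "(\<Sum>j\<in>UNIV. \<Sum>i\<in>UNIV. N $ i $ j) = ?S"
      by (rule sum.swap)
    have ai: "a $ i = (\<Sum>j\<in>UNIV. N $ i $ j) / ?n - wt N"
      and bi: "b $ i = (\<Sum>j\<in>UNIV. N $ j $ i) / ?n - wt N" for i
      using R by simp_all
    have a0: "(\<Sum>i\<in>UNIV. a $ i) = 0"
      by (simp add: ai sum_subtractf w flip: sum_divide_distrib)
    have b0: "(\<Sum>i\<in>UNIV. b $ i) = 0"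
      by (simp add: bi sum_subtractf w S' flip: sum_divide_distrib)
    have N0: "N0 $ i $ j = N $ i $ j - a $ i - b $ j - wt N" for i j
      using R by (simp add: outer_def ones_matrix_def)
    have "(\<Sum>j\<in>UNIV. N0 $ i $ j) = 0" for i
      by (simp add: N0 sum_subtractf b0) (simp add: ai field_simps)
    moreover have "(\<Sum>i\<in>UNIV. N0 $ i $ j) = 0" for j
      by (simp add: N0 sum_subtractf a0) (simp add: bi field_simps)
    moreover have "N = outer a 1 + outer 1 b + N0 + wt N *\<^sub>R ones_matrix"
      by (simp add: vec_eq_iff N0 outer_def ones_matrix_def)
    ultimately show ?L
      using a0 b0 unfolding canonical_decomposition_def by blast
  qed
qed

end

theory Submission
  imports Defs
begin

text \<open>Summing all entries of \<open>A B\<close> gives the inner product of the column sums of \<open>A\<close> with the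
  row sums of \<open>B\<close>. These are \<open>n (b + wt A)\<close> and \<open>n (a' + wt B)\<close>, and the mixed terms vanish since \<open>b\<close>
  and \<open>a'\<close> have coordinate sum zero. The case \<open>A = N\<^sup>T\<close> exchanges the roles of \<open>a\<close> and \<open>b\<close>.\<close>

lemma canonical_decomposition_row_sum:
  fixes N :: "real ^ 'n ^ 'n"
  assumes "canonical_decomposition N a b N0"
  shows "(\<Sum>j\<in>UNIV. N $ i $ j) = real CARD('n) * (a $ i + wt N)"
  using assms by (simp add: canonical_decomposition_iff)

lemma canonical_decomposition_col_sum:
  fixes N :: "real ^ 'n ^ 'n"
  assumes "canonical_decomposition N a b N0"
  shows "(\<Sum>i\<in>UNIV. N $ i $ j) = real CARD('n) * (b $ j + wt N)"
  using assms by (simp add: canonical_decomposition_iff)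

lemma wt_transpose: "wt (transpose N) = wt N"
  unfolding wt_def transpose_def by (simp add: sum.swap[of "\<lambda>i j. N $ j $ i"])

text \<open>By uniqueness it suffices to compare the explicit formulas for the components:
  \<open>wt\<close> is invariant under transposition, while row averages become column
  averages.\<close>

lemma canonical_decomposition_transpose:
  assumes "canonical_decomposition N a b N0"
  shows "canonical_decomposition (transpose N) b a (transpose N0)"
  using assms unfolding canonical_decomposition_iff
  by (simp add: wt_transpose) (simp add: vec_eq_iff transpose_def outer_def ones_matrix_def)

text \<open>Two independent factors are allowed so that \<open>transpose N ** N\<close> and
  \<open>N ** N\<close> are both instances.\<close>

lemma wt_matrix_mult:
  fixes A B :: "real ^ 'n ^ 'n"
  assumes A: "canonical_decomposition A a b A0" and B: "canonical_decomposition B a' b' B0"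
  shows "wt (A ** B) = real CARD('n) * wt A * wt B + (\<Sum>k\<in>UNIV. b $ k * a' $ k)"
proof -
  let ?n = "real CARD('n)"
  \<comment> \<open>For fixed \<open>i\<close>, the sums over \<open>j\<close> and \<open>k\<close>
    are exchanged, which isolates the row sums of \<open>B\<close>; exchanging \<open>i\<close> and
    \<open>k\<close> next isolates the column sums of \<open>A\<close>.\<close>
  have "(\<Sum>i\<in>UNIV. \<Sum>j\<in>UNIV. (A ** B) $ i $ j)
      = (\<Sum>i\<in>UNIV. \<Sum>k\<in>UNIV. A $ i $ k * (\<Sum>j\<in>UNIV. B $ k $ j))"
    unfolding matrix_matrix_mult_def
    by (simp add: sum_distrib_left) (intro sum.cong refl sum.swap)
  also have "\<dots> = (\<Sum>k\<in>UNIV. (\<Sum>i\<in>UNIV. A $ i $ k) * (\<Sum>j\<in>UNIV. B $ k $ j))"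
    by (subst sum.swap) (simp add: sum_distrib_right)
  also have "\<dots> = (\<Sum>k\<in>UNIV. ?n\<^sup>2 * (b $ k * a' $ k + wt A * a' $ k + wt B * b $ k + wt A * wt B))"
    by (simp add: canonical_decomposition_col_sum[OF A] canonical_decomposition_row_sum[OF B]
        algebra_simps power2_eq_square)
  also have "\<dots> = ?n\<^sup>2 * ((\<Sum>k\<in>UNIV. b $ k * a' $ k) + wt A * (\<Sum>k\<in>UNIV. a' $ k)
      + wt B * (\<Sum>k\<in>UNIV. b $ k) + ?n * wt A * wt B)"
    by (simp add: sum.distrib flip: sum_distrib_left)
  also have "\<dots> = ?n\<^sup>2 * (?n * wt A * wt B + (\<Sum>k\<in>UNIV. b $ k * a' $ k))"
    using A B by (simp add: canonical_decomposition_def)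
  \<comment> \<open>The factor \<open>?n\<^sup>2\<close> cancels against the normalisation in
    \<open>wt\<close>.\<close>
  finally show ?thesis
    unfolding wt_def[of "A ** B"] by simp
qed

lemma real_matrix_mult: "real_matrix (A ** B) = real_matrix A ** real_matrix B"
  by (simp add: real_matrix_def map_matrix_def matrix_matrix_mult_def vec_eq_iff)

lemma real_matrix_transpose: "real_matrix (transpose A) = transpose (real_matrix A)"
  by (simp add: real_matrix_def map_matrix_def transpose_def vec_eq_iff)

lemma wt_real_matrix_in_Ints: "(real CARD('n))\<^sup>2 * wt (real_matrix (N :: int ^ 'n ^ 'n)) \<in> \<int>"
  by (simp add: wt_def real_matrix_def map_matrix_def Ints_sum)

text \<open>Scaling by the square of the dimension turns the row average into a multiple of an
  integer row sum and clears the denominator of \<open>wt\<close>. The claim for \<open>b\<close> is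
  this one applied to the transpose.\<close>

lemma canonical_decomposition_in_Ints:
  fixes N :: "int ^ 'n ^ 'n"
  assumes "canonical_decomposition (real_matrix N) a b N0"
  shows "(real CARD('n))\<^sup>2 * a $ i \<in> \<int>"
proof -
  let ?n = "real CARD('n)"
  have "?n\<^sup>2 * a $ i = ?n * (\<Sum>j\<in>UNIV. real_matrix N $ i $ j) - ?n\<^sup>2 * wt (real_matrix N)"
    unfolding canonical_decomposition_row_sum[OF assms] by (simp add: algebra_simps power2_eq_square)
  also have "\<dots> \<in> \<int>"
    by (intro Ints_diff wt_real_matrix_in_Ints Ints_mult Ints_of_nat Ints_sum)
      (simp add: real_matrix_def map_matrix_def)
  finally show ?thesis .
qed

theorem corollary3p1:
  fixes M :: "int ^ 'n ^ 'n"
  defines "n \<equiv> real CARD('n)"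
  shows
    "(\<forall>(N :: int ^ 'n ^ 'n) a b N0.
        M = transpose N ** N \<and> canonical_decomposition (real_matrix N) a b N0 \<longrightarrow>
          n\<^sup>2 * wt (real_matrix N) \<in> \<int> \<and>
          (\<forall>j. n\<^sup>2 * a $ j \<in> \<int> \<and> n\<^sup>2 * b $ j \<in> \<int>) \<and>
          n ^ 4 * wt (real_matrix M)
            = n * (n\<^sup>2 * wt (real_matrix N))\<^sup>2 + (\<Sum>j\<in>UNIV. (n\<^sup>2 * a $ j)\<^sup>2)) \<and>
     (\<forall>(N :: int ^ 'n ^ 'n) a b N0.
        M = N ** N \<and> canonical_decomposition (real_matrix N) a b N0 \<longrightarrow>
          n\<^sup>2 * wt (real_matrix N) \<in> \<int> \<and>
          (\<forall>j. n\<^sup>2 * a $ j \<in> \<int> \<and> n\<^sup>2 * b $ j \<in> \<int>) \<and>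
          n ^ 4 * wt (real_matrix M)
            = n * (n\<^sup>2 * wt (real_matrix N))\<^sup>2 + (\<Sum>j\<in>UNIV. (n\<^sup>2 * a $ j) * (n\<^sup>2 * b $ j)))"
proof (intro conjI allI impI; elim conjE)
  fix N :: "int ^ 'n ^ 'n" and a b N0
  assume D: "canonical_decomposition (real_matrix N) a b N0"
  note T = canonical_decomposition_transpose[OF D]
  \<comment> \<open>Each integrality claim occurs twice, once for each of the two products.\<close>
  show "n\<^sup>2 * wt (real_matrix N) \<in> \<int>" "n\<^sup>2 * wt (real_matrix N) \<in> \<int>"
    unfolding n_def by (fact wt_real_matrix_in_Ints)+
  show "n\<^sup>2 * a $ j \<in> \<int>" "n\<^sup>2 * a $ j \<in> \<int>" for j
    unfolding n_def by (fact canonical_decomposition_in_Ints[OF D])+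
  show "n\<^sup>2 * b $ j \<in> \<int>" "n\<^sup>2 * b $ j \<in> \<int>" for j
    unfolding n_def using canonical_decomposition_in_Ints[of "transpose N"] T
    by (simp_all add: real_matrix_transpose)
  \<comment> \<open>In \<open>T\<close> the column component of \<open>transpose N\<close> is
    \<open>a\<close>, which is also the row component of \<open>N\<close> in \<open>D\<close>; hence
    the squares. The factor \<open>n ^ 4\<close> is shared out as one \<open>n\<^sup>2\<close> for
    each of the two factors in every product.\<close>
  show "n ^ 4 * wt (real_matrix M)
      = n * (n\<^sup>2 * wt (real_matrix N))\<^sup>2 + (\<Sum>j\<in>UNIV. (n\<^sup>2 * a $ j)\<^sup>2)"
    if "M = transpose N ** N"
    by (simp add: that real_matrix_mult real_matrix_transpose wt_matrix_mult[OF T D] wt_transpose n_def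
        algebra_simps power2_eq_square power4_eq_xxxx sum_distrib_left)
  \<comment> \<open>Here the left factor is \<open>N\<close> itself, so its column component
    \<open>b\<close> meets the row component \<open>a\<close>.\<close>
  show "n ^ 4 * wt (real_matrix M)
      = n * (n\<^sup>2 * wt (real_matrix N))\<^sup>2 + (\<Sum>j\<in>UNIV. (n\<^sup>2 * a $ j) * (n\<^sup>2 * b $ j))"
    if "M = N ** N"
    by (simp add: that real_matrix_mult wt_matrix_mult[OF D D] n_def
        algebra_simps power2_eq_square power4_eq_xxxx sum_distrib_left)
qed

end
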